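(* Let $n \in \{48, 72\}$ and let $C \subseteq \mathbb{F}_2^n$ be an extremal Type~II code of length $n$, with minimal nonzero weight $m$. Then $C$ is spanned (over $\mathbb{F}_2$) by its codewords of weight $m$, i.e. $C = \langle \{c \in C : \mathrm{wt}(c) = m\}\rangle$.
   Context: A (binary linear) code of length $n$ is a linear subspace of $\mathbb{F}_2^n$. The Hamming weight $\mathrm{wt}(c)$ is the number of coordinates $i$ with $c_i = 1$. The dual code is $C^\perp = \{c' \in \mathbb{F}_2^n : \sum_i c_i c'_i = 0 \text{ for all } c \in C\}$; $C$ is self-dual if $C = C^\perp$. A code is of Type~II if it is self-dual and doubly even, i.e. $4 \mid \mathrm{wt}(c)$ for all $c \in C$. A Type~II code of length $n$ is extremal if it has no nonzero codewords of weight less than $4\lfloor n/24\rfloor + 4$ (so its minimal nonzero weight is $4\lfloor n/24\rfloor+4$). *)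

theory Defs
  imports "HOL-Library.Z2" "HOL-Analysis.Analysis"
begin

text \<open>
  The space \<open>\<F>\<^sub>2\<^sup>n\<close> is rendered as \<^typ>\<open>bit ^ 'n\<close> with \<^term>\<open>n = CARD('n)\<close>.
  Linear subspaces and spans over \<^typ>\<open>bit\<close> are \<^const>\<open>vec.subspace\<close> and \<^const>\<open>vec.span\<close>
  (the unqualified notions refer to real vector spaces).
\<close>

definition hamming_weight :: "bit ^ 'n \<Rightarrow> nat" where
  "hamming_weight c = card {i. c $ i = 1}"

definition dual_code :: "(bit ^ 'n) set \<Rightarrow> (bit ^ 'n) set" where
  "dual_code C = {c'. \<forall>c\<in>C. (\<Sum>i\<in>UNIV. c $ i * c' $ i) = 0}"

definition self_dual :: "(bit ^ 'n) set \<Rightarrow> bool" where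
  "self_dual C \<longleftrightarrow> vec.subspace C \<and> C = dual_code C"

definition doubly_even :: "(bit ^ 'n) set \<Rightarrow> bool" where
  "doubly_even C \<longleftrightarrow> (\<forall>c\<in>C. 4 dvd hamming_weight c)"

definition type_II :: "(bit ^ 'n) set \<Rightarrow> bool" where
  "type_II C \<longleftrightarrow> self_dual C \<and> doubly_even C"

definition extremal_type_II :: "(bit ^ 'n) set \<Rightarrow> bool" where
  "extremal_type_II C \<longleftrightarrow> type_II C \<and>
     (\<forall>c\<in>C. c \<noteq> 0 \<longrightarrow> \<not> hamming_weight c < 4 * (CARD('n) div 24) + 4)"

definition min_weight :: "(bit ^ 'n) set \<Rightarrow> nat" where
  "min_weight C = Min (hamming_weight ` (C - {0}))"

end

theory Submission imports Defs begin

text \<open>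
  Let \<open>d\<close> be the extremal minimum weight and suppose that the words of weight \<open>d\<close> do not span \<open>C\<close>.
  Choose \<open>c \<in> C\<close> of least weight \<open>w\<close> outside their span. A word \<open>x\<close> of weight \<open>d\<close> meets \<open>c\<close> in an
  even number of positions, and in at most \<open>d/2\<close>, as otherwise \<open>x + c\<close> would be a shorter word outside the span.
  Let \<open>P\<close> have the roots \<open>0, 2, \<dots>\<close> up to \<open>d/2\<close> and \<open>Q\<close> the roots \<open>d + 4, d + 8, \<dots>, n - d\<close>.
  The function \<open>f(x) = P(|x \<inter> c|) Q(|x|)\<close> vanishes on \<open>C\<close> except at the all-one word. Its degree
  is less than \<open>d\<close>, the dual distance of \<open>C\<close>, so its averages over \<open>C\<close> and over the whole space agree. Since
  \<open>C\<close> has \<open>2\<^sup>n\<^sup>/\<^sup>2\<close> elements, this gives \<open>2\<^sup>n\<^sup>/\<^sup>2 P(w) Q(n) = \<Sum>f\<close>, where the sum is over the whole space;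
  for \<open>n = 48\<close> and \<open>n = 72\<close> the equation fails for every multiple \<open>w\<close> of 4 with \<open>d < w \<le> n\<close>.
\<close>

section \<open>Supports, weights and orthogonality\<close>

definition support :: "bit ^ 'n \<Rightarrow> 'n set" where
  "support x = {i. x $ i = 1}"

text \<open>The additive character, -1 to the power of the inner product of \<open>u\<close> and
  \<open>x\<close>, with integer values so that all later sums are exact.\<close>

definition character :: "bit ^ 'n \<Rightarrow> bit ^ 'n \<Rightarrow> int" where
  "character u x = (if even (card (support u \<inter> support x)) then 1 else -1)"

lemma hamming_weight_eq: "hamming_weight x = card (support x)"
  by (simp add: hamming_weight_def support_def)

lemma support_eq_empty_iff: "support x = {} \<longleftrightarrow> x = 0"
  by (auto simp: support_def vec_eq_iff)

lemma support_eq_UNIV_iff: "support x = UNIV \<longleftrightarrow> x = 1"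
  by (auto simp: support_def vec_eq_iff)

lemma support_add: "support (x + y) = (support x - support y) \<union> (support y - support x)"
proof -
  have "a + b = 1 \<longleftrightarrow> (a = 1 \<and> b \<noteq> 1) \<or> (b = 1 \<and> a \<noteq> 1)" for a b :: bit
    by (cases a; cases b) auto
  then show ?thesis by (auto simp: support_def)
qed

lemma card_support_add_Int:
  fixes x y :: "bit ^ 'n"
  shows "card (support (x + y) \<inter> A) + 2 * card (support x \<inter> support y \<inter> A)
    = card (support x \<inter> A) + card (support y \<inter> A)"
proof -
  have "card (S \<inter> A) = card ((S - T) \<inter> A) + card (S \<inter> T \<inter> A)" for S T :: "'n set"
    by (subst card_Un_disjoint [symmetric]) (auto intro: arg_cong [where f = card])
  from this [of "support x" "support y"] this [of "support y" "support x"]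
  have "card (support x \<inter> A) + card (support y \<inter> A)
      = card ((support x - support y) \<inter> A) + card ((support y - support x) \<inter> A) + 2 * card (support x \<inter> support y \<inter> A)"
    by (simp add: Int_commute)
  also have "card ((support x - support y) \<inter> A) + card ((support y - support x) \<inter> A) = card (support (x + y) \<inter> A)"
    unfolding support_add by (subst card_Un_disjoint [symmetric]) (auto intro: arg_cong [where f = card])
  finally show ?thesis by simp
qed

lemma hamming_weight_add:
  "hamming_weight (x + y) + 2 * card (support x \<inter> support y) = hamming_weight x + hamming_weight y"
  using card_support_add_Int [of x y UNIV] by (simp add: hamming_weight_eq)

lemma support_axis: "support (axis i 1) = {i}"
  by (auto simp: support_def axis_def split: if_splits)

lemma bij_support: "bij (support :: bit ^ 'n \<Rightarrow> 'n set)"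
proof (rule bijI')
  show "support x = support y \<longleftrightarrow> x = y" for x y :: "bit ^ 'n"
  proof
    assume "support x = support y"
    then have "\<forall>i. (x $ i = 1) = (y $ i = 1)" by (auto simp: support_def)
    then show "x = y" by (metis bit_not_one_iff vec_eq_iff)
  qed simp
  show "\<exists>x. S = support x" for S :: "'n set"
    by (rule exI [of _ "\<chi> i. if i \<in> S then 1 else 0"]) (auto simp: support_def)
qed

lemma finite_bit_vec: "finite (S :: (bit ^ 'n) set)"
  using bij_betw_finite [OF bij_support] finite_subset [of S UNIV] by simp

lemma card_UNIV_bit_vec: "card (UNIV :: (bit ^ 'n) set) = 2 ^ CARD('n)"
proof -
  have "card (UNIV :: (bit ^ 'n) set) = card (Pow (UNIV :: 'n set))"
    unfolding Pow_UNIV by (rule bij_betw_same_card [OF bij_support])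
  then show ?thesis by (simp only: card_Pow finite)
qed

lemma of_nat_bit_eq_0_iff: "(of_nat k :: bit) = 0 \<longleftrightarrow> even k"
  by (induction k) auto

lemma mem_dual_code_iff: "u \<in> dual_code C \<longleftrightarrow> (\<forall>x\<in>C. even (card (support u \<inter> support x)))"
proof -
  have "(\<Sum>i\<in>UNIV. x $ i * u $ i) = 0 \<longleftrightarrow> even (card (support u \<inter> support x))" for x
    by (simp add: support_def Int_def conj_commute of_nat_bit_eq_0_iff)
  then show ?thesis by (simp only: dual_code_def mem_Collect_eq)
qed

section \<open>Character sums and the size of the dual code\<close>

lemma character_commute: "character u x = character x u"
  by (simp add: character_def Int_commute)

lemma character_add_left: "character (u + v) x = character u x * character v x"
proof -
  have "even (card (support (u + v) \<inter> support x))
      \<longleftrightarrow> even (card (support u \<inter> support x) + card (support v \<inter> support x))"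
    unfolding card_support_add_Int [symmetric] by simp
  then show ?thesis by (simp add: character_def)
qed

lemma character_add_right: "character u (x + y) = character u x * character u y"
  by (metis character_add_left character_commute)

lemma character_axis: "character (axis i 1) x = (if i \<in> support x then -1 else 1)"
  by (simp add: character_def support_axis)

text \<open>If some \<open>z\<close> in \<open>D\<close> has character value -1, translation by
  \<open>z\<close> permutes \<open>D\<close> and negates the sum, which is therefore zero.\<close>

lemma sum_character:
  fixes D :: "(bit ^ 'n) set"
  assumes "vec.subspace D"
  shows "(\<Sum>x\<in>D. character u x) = (if u \<in> dual_code D then int (card D) else 0)"
proof (cases "u \<in> dual_code D")
  case True
  then have "character u x = 1" if "x \<in> D" for x
    using that by (simp add: character_def mem_dual_code_iff)
  then show ?thesis using True by simp
next
  case False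
  then obtain z where z: "z \<in> D" "character u z = -1"
    by (auto simp: character_def mem_dual_code_iff)
  have "(\<Sum>x\<in>D. character u x) = (\<Sum>x\<in>D. character u (x + z))"
  proof (rule sum.reindex_bij_witness [of _ "\<lambda>x. x + z" "\<lambda>x. x - z"])
  qed (use assms z in \<open>auto intro: vec.subspace_add vec.subspace_diff\<close>)
  then show ?thesis using z(2) False by (simp add: character_add_right sum_negf)
qed

lemma dual_code_UNIV: "dual_code (UNIV :: (bit ^ 'n) set) = {0}"
proof -
  have "u = 0" if "u \<in> dual_code UNIV" for u :: "bit ^ 'n"
  proof -
    have "even (card (support u \<inter> support (axis i 1)))" for i
      using that by (auto simp: mem_dual_code_iff)
    then have "i \<notin> support u" for i
      by (metis Int_insert_right_if1 Int_empty_right card.empty card_insert_disjoint finite.emptyI empty_iff odd_one One_nat_def support_axis)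
    then show ?thesis by (auto simp flip: support_eq_empty_iff)
  qed
  then show ?thesis by (auto simp: dual_code_def)
qed

lemma sum_character_UNIV:
  "(\<Sum>x\<in>UNIV. character (u :: bit ^ 'n) x) = (if u = 0 then 2 ^ CARD('n) else 0)"
  using sum_character [OF vec.subspace_UNIV, of u] by (simp only: dual_code_UNIV card_UNIV_bit_vec singleton_iff of_nat_power of_nat_numeral)

text \<open>Sum the characters over \<open>C\<close> and the whole space in both orders: the inner
  sum over \<open>C\<close> detects the dual code, the one over the whole space detects the zero
  word.\<close>

lemma card_mult_card_dual_code:
  fixes C :: "(bit ^ 'n) set"
  assumes "vec.subspace C"
  shows "card C * card (dual_code C) = 2 ^ CARD('n)"
proof -
  have "(\<Sum>y\<in>UNIV. \<Sum>x\<in>C. character y x) = (\<Sum>y\<in>UNIV. if y \<in> dual_code C then int (card C) else 0)"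
    by (simp add: sum_character [OF assms])
  also have "\<dots> = int (card C * card (dual_code C))"
    by (subst sum.If_cases) (auto simp: finite_bit_vec)
  finally have "int (card C * card (dual_code C)) = (\<Sum>x\<in>C. \<Sum>y\<in>UNIV. character x y)"
    by (subst (asm) sum.swap) (simp add: character_commute)
  also have "\<dots> = (\<Sum>x\<in>C. if x = 0 then 2 ^ CARD('n) else 0)"
    by (simp add: sum_character_UNIV)
  also have "\<dots> = int (2 ^ CARD('n))"
    using vec.subspace_0 [OF assms] by (simp add: finite_bit_vec)
  finally show ?thesis by (simp only: of_nat_eq_iff)
qed

section \<open>Averages over a code and over the whole space\<close>

text \<open>Up to normalisation, \<open>f\<close> on \<open>C\<close> and \<open>f\<close> on the
  whole space have equal Fourier coefficients at all frequencies of weight at most \<open>r\<close>.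
  Frequencies other than 0 are included to allow induction over linear factors; cross-multiplication
  avoids division.\<close>

definition balanced :: "(bit ^ 'n) set \<Rightarrow> nat \<Rightarrow> (bit ^ 'n \<Rightarrow> int) \<Rightarrow> bool" where
  "balanced C r f \<longleftrightarrow> (\<forall>u. hamming_weight u \<le> r \<longrightarrow>
     2 ^ CARD('n) * (\<Sum>x\<in>C. f x * character u x) = int (card C) * (\<Sum>x\<in>UNIV. f x * character u x))"

text \<open>The two sums are nonzero only for \<open>u\<close> in the dual code and for
  \<open>u = 0\<close> respectively; up to weight \<open>r\<close> these conditions
  coincide.\<close>

lemma balanced_const:
  assumes "vec.subspace C" and "\<And>u. u \<in> dual_code C \<Longrightarrow> hamming_weight u \<le> r \<Longrightarrow> u = 0"
  shows "balanced C r (\<lambda>_. 1)"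
proof -
  have "0 \<in> dual_code C" by (simp add: dual_code_def)
  then show ?thesis
    using assms(2) by (auto simp: balanced_def sum_character [OF assms(1)] sum_character_UNIV)
qed

lemma hamming_weight_add_axis_le: "hamming_weight (u + axis i 1) \<le> Suc (hamming_weight u)"
  using hamming_weight_add [of u "axis i 1"] by (simp add: hamming_weight_eq support_axis)

text \<open>The intersection number is half of \<open>card A\<close> minus the sum of the characters of the
  unit vectors in \<open>A\<close>, and each of these shifts a frequency \<open>u\<close> by weight at most one.\<close>

lemma balanced_mult_linear:
  fixes C :: "(bit ^ 'n) set"
  assumes "balanced C (Suc r) f"
  shows "balanced C r (\<lambda>x. (int (card (support x \<inter> A)) - v) * f x)"
  unfolding balanced_def
proof (intro allI impI)
  fix u :: "bit ^ 'n" assume u: "hamming_weight u \<le> r"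
  have "(\<Sum>i\<in>A. character (axis i 1) x) = int (card A) - 2 * int (card (support x \<inter> A))" for x :: "bit ^ 'n"
  proof -
    have "(\<Sum>i\<in>A. character (axis i 1) x) = (\<Sum>i\<in>A. 1 - 2 * (if i \<in> support x then 1 else 0))"
      by (rule sum.cong) (auto simp: character_axis)
    also have "\<dots> = int (card A) - 2 * (\<Sum>i\<in>A. if i \<in> support x then 1 else 0)"
      by (simp add: sum_subtractf flip: sum_distrib_left)
    also have "(\<Sum>i\<in>A. if i \<in> support x then 1 else 0) = int (card (support x \<inter> A))"
      by (subst sum.If_cases) (auto simp: Int_commute)
    finally show ?thesis .
  qed
  \<comment> \<open>Doubling clears the half in the formula for the intersection number; the factor
    2 is cancelled at the end.\<close>
  then have "2 * ((int (card (support x \<inter> A)) - v) * f x * character u x)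
      = (int (card A) - 2 * v) * (f x * character u x)
        - (\<Sum>i\<in>A. f x * character (u + axis i 1) x)" for x :: "bit ^ 'n"
    by (simp add: character_add_left mult.assoc flip: sum_distrib_left) (simp add: algebra_simps)
  then have expand: "2 * (\<Sum>x\<in>D. (int (card (support x \<inter> A)) - v) * f x * character u x)
      = (int (card A) - 2 * v) * (\<Sum>x\<in>D. f x * character u x)
        - (\<Sum>i\<in>A. \<Sum>x\<in>D. f x * character (u + axis i 1) x)" for D :: "(bit ^ 'n) set"
    by (subst sum.swap [of _ D A]) (simp add: sum_distrib_left sum_subtractf)
  have shift: "2 ^ CARD('n) * (\<Sum>x\<in>C. f x * character t x) = int (card C) * (\<Sum>x\<in>UNIV. f x * character t x)"
    if "hamming_weight t \<le> Suc r" for t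
    using assms that by (simp add: balanced_def)
  have "hamming_weight (u + axis i 1) \<le> Suc r" for i
    using hamming_weight_add_axis_le [of u i] u by simp
  then have "2 ^ CARD('n) * (\<Sum>i\<in>A. \<Sum>x\<in>C. f x * character (u + axis i 1) x)
      = int (card C) * (\<Sum>i\<in>A. \<Sum>x\<in>UNIV. f x * character (u + axis i 1) x)"
    unfolding sum_distrib_left [of _ _ A] by (intro sum.cong shift refl)
  moreover have "2 ^ CARD('n) * ((int (card A) - 2 * v) * (\<Sum>x\<in>C. f x * character u x))
      = int (card C) * ((int (card A) - 2 * v) * (\<Sum>x\<in>UNIV. f x * character u x))"
    using shift [of u] u by (simp add: mult.left_commute)
  ultimately have "2 ^ CARD('n) * (2 * (\<Sum>x\<in>C. (int (card (support x \<inter> A)) - v) * f x * character u x))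
      = int (card C) * (2 * (\<Sum>x\<in>UNIV. (int (card (support x \<inter> A)) - v) * f x * character u x))"
    unfolding expand right_diff_distrib by simp
  then show "2 ^ CARD('n) * (\<Sum>x\<in>C. (int (card (support x \<inter> A)) - v) * f x * character u x)
      = int (card C) * (\<Sum>x\<in>UNIV. (int (card (support x \<inter> A)) - v) * f x * character u x)"
    by simp
qed

text \<open>The monic polynomial with roots \<open>vs\<close>, evaluated in the integers so that
  differences are not truncated.\<close>

definition root_prod :: "nat list \<Rightarrow> nat \<Rightarrow> int" where
  "root_prod vs k = (\<Prod>v\<leftarrow>vs. int k - int v)"

lemma root_prod_eq_0: "k \<in> set vs \<Longrightarrow> root_prod vs k = 0"
  by (auto simp: root_prod_def prod_list_zero_iff)

lemma balanced_mult_root_prod: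
  "balanced C (r + length vs) f \<Longrightarrow> balanced C r (\<lambda>x. root_prod vs (card (support x \<inter> A)) * f x)"
proof (induction vs arbitrary: r)
  case (Cons v vs)
  then have "balanced C (Suc r) (\<lambda>x. root_prod vs (card (support x \<inter> A)) * f x)" by simp
  then have "balanced C r (\<lambda>x. (int (card (support x \<inter> A)) - int v) * (root_prod vs (card (support x \<inter> A)) * f x))"
    by (rule balanced_mult_linear)
  then show ?case by (simp add: root_prod_def mult.assoc)
qed (simp add: root_prod_def)

text \<open>Each linear factor costs one unit of \<open>r\<close>. Starting from the total degree,
  frequency 0 is still available at the end, and there the plain sums are compared. The factors from
  \<open>us\<close> are the case \<open>A = UNIV\<close>.\<close>

lemma sum_dual_distance:
  fixes C :: "(bit ^ 'n) set"
  assumes "vec.subspace C"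
    and "\<And>u. u \<in> dual_code C \<Longrightarrow> u \<noteq> 0 \<Longrightarrow> length vs + length us < hamming_weight u"
  shows "2 ^ CARD('n) * (\<Sum>x\<in>C. root_prod vs (card (support x \<inter> A)) * root_prod us (card (support x)))
    = int (card C) * (\<Sum>x\<in>UNIV. root_prod vs (card (support x \<inter> A)) * root_prod us (card (support x)))"
proof -
  have "balanced C (length vs + length us) (\<lambda>_. 1)"
    using assms by (intro balanced_const) force+
  then have "balanced C (length vs) (\<lambda>x. root_prod us (card (support x \<inter> UNIV)) * 1)"
    by (rule balanced_mult_root_prod)
  then have "balanced C 0 (\<lambda>x. root_prod vs (card (support x \<inter> A)) * root_prod us (card (support x)))"
    using balanced_mult_root_prod [of C 0 vs] by simp
  moreover have "hamming_weight (0 :: bit ^ 'n) = 0" by (simp add: hamming_weight_def)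
  moreover have "character 0 x = 1" for x :: "bit ^ 'n" by (simp add: character_def support_def)
  ultimately show ?thesis
    unfolding balanced_def by (metis (no_types, lifting) le_refl mult.right_neutral sum.cong)
qed

section \<open>Evaluating sums over all subsets\<close>

text \<open>This is the binomial sum of \<open>(k choose i) * h i\<close> over \<open>i\<close>; the
  recursion omits or includes one element of the underlying set.\<close>

fun subset_sum :: "nat \<Rightarrow> (nat \<Rightarrow> int) \<Rightarrow> int" where
  "subset_sum 0 h = h 0"
| "subset_sum (Suc k) h = subset_sum k (\<lambda>i. h i + h (Suc i))"

lemma sum_Pow_card: "finite A \<Longrightarrow> (\<Sum>B\<in>Pow A. h (card B)) = subset_sum (card A) h"
proof (induction A arbitrary: h rule: finite_induct)
  case (insert a A)
  have "(\<Sum>B\<in>insert a ` Pow A. h (card B)) = (\<Sum>B\<in>Pow A. h (card (insert a B)))"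
    using insert.hyps by (subst sum.reindex) (auto simp: inj_on_def)
  also have "\<dots> = (\<Sum>B\<in>Pow A. h (Suc (card B)))"
  proof (rule sum.cong)
    fix B assume "B \<in> Pow A"
    then have "finite B" "a \<notin> B" using insert.hyps finite_subset by auto
    then show "h (card (insert a B)) = h (Suc (card B))" by simp
  qed simp
  finally have "(\<Sum>B\<in>Pow (insert a A). h (card B)) = (\<Sum>B\<in>Pow A. h (card B) + h (Suc (card B)))"
    using insert.hyps unfolding Pow_insert by (subst sum.union_disjoint) (auto simp: sum.distrib)
  then show ?case using insert by simp
qed simp

text \<open>A support splits into its parts inside and outside \<open>A\<close>, which are chosen
  independently.\<close>

lemma sum_support_eq_subset_sum:
  fixes A :: "'n::finite set"
  shows "(\<Sum>x\<in>UNIV. p (card (support (x :: bit ^ 'n) \<inter> A)) * q (card (support x)))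
    = subset_sum (card A) (\<lambda>a. p a * subset_sum (CARD('n) - card A) (\<lambda>b. q (a + b)))"
proof -
  have "(\<Sum>x\<in>UNIV. p (card (support (x :: bit ^ 'n) \<inter> A)) * q (card (support x)))
      = (\<Sum>S\<in>UNIV. p (card (S \<inter> A)) * q (card S))"
    by (rule sum.reindex_bij_betw [OF bij_support])
  also have "\<dots> = (\<Sum>(S, T)\<in>Pow A \<times> Pow (- A). p (card S) * q (card S + card T))"
  proof (rule sum.reindex_bij_witness [of _ "\<lambda>(S, T). S \<union> T" "\<lambda>S. (S \<inter> A, S - A)"])
    fix S :: "'n set"
    have "card (S \<inter> A) + card (S - A) = card S"
      by (subst card_Un_disjoint [symmetric]) (auto intro: arg_cong [where f = card])
    then show "(case (S \<inter> A, S - A) of (S, T) \<Rightarrow> p (card S) * q (card S + card T)) = p (card (S \<inter> A)) * q (card S)"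
      by simp
  qed auto
  also have "\<dots> = (\<Sum>S\<in>Pow A. p (card S) * (\<Sum>T\<in>Pow (- A). q (card S + card T)))"
    by (simp add: sum.cartesian_product sum_distrib_left)
  also have "\<dots> = (\<Sum>S\<in>Pow A. p (card S) * subset_sum (CARD('n) - card A) (\<lambda>b. q (card S + b)))"
    by (subst sum_Pow_card [of "- A"]) (auto simp: Compl_eq_Diff_UNIV card_Diff_subset)
  also have "\<dots> = subset_sum (card A) (\<lambda>a. p a * subset_sum (CARD('n) - card A) (\<lambda>b. q (a + b)))"
    by (rule sum_Pow_card) simp
  finally show ?thesis .
qed

fun adjacent_sums :: "int list \<Rightarrow> int list" where
  "adjacent_sums (x # y # zs) = (x + y) # adjacent_sums (y # zs)"
| "adjacent_sums _ = []"

lemma adjacent_sums_map: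
  "adjacent_sums (map h [a..<Suc b]) = map (\<lambda>i. h i + h (Suc i)) [a..<b]"
proof (induction "b - a" arbitrary: a)
  case (Suc k)
  then have "a < b" by simp
  then have "[a..<Suc b] = a # Suc a # [Suc (Suc a)..<Suc b]" "[Suc a..<Suc b] = Suc a # [Suc (Suc a)..<Suc b]"
    "[a..<b] = a # [Suc a..<b]"
    by (simp_all add: upt_conv_Cons del: upt_Suc)
  then show ?case using Suc.hyps(1) [of "Suc a"] Suc.hyps(2) by (simp del: upt_Suc)
qed (cases "a = b"; simp)

text \<open>All shifts of \<open>h\<close> are treated at once, so additions are shared, whereas
  unfolding \<open>subset_sum\<close> evaluates \<open>h\<close> exponentially often.\<close>

lemma funpow_adjacent_sums_map:
  "(adjacent_sums ^^ k) (map h [0..<m + k]) = map (\<lambda>a. subset_sum k (\<lambda>b. h (a + b))) [0..<m]"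
proof (induction k arbitrary: h)
  case (Suc k)
  have "(adjacent_sums ^^ Suc k) (map h [0..<m + Suc k]) = (adjacent_sums ^^ k) (adjacent_sums (map h [0..<Suc (m + k)]))"
    by (simp add: funpow_swap1 del: upt_Suc)
  then show ?case by (simp only: adjacent_sums_map Suc.IH) simp
qed simp

lemma subset_sum_mult_eq:
  assumes "w \<le> n"
  shows "subset_sum w (\<lambda>a. p a * subset_sum (n - w) (\<lambda>b. q (a + b)))
    = hd ((adjacent_sums ^^ w) (map2 (*) (map p [0..<Suc w]) ((adjacent_sums ^^ (n - w)) (map q [0..<Suc n]))))"
proof -
  \<comment> \<open>The first \<open>n - w\<close> rounds leave the values for \<open>a = 0\<close>
    up to \<open>w\<close>; after multiplication by \<open>p\<close>, another \<open>w\<close>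
    rounds leave a single entry.\<close>
  have n: "Suc n = Suc w + (n - w)" using assms by simp
  have "map2 (*) (map p [0..<Suc w]) ((adjacent_sums ^^ (n - w)) (map q [0..<Suc n]))
      = map (\<lambda>a. p a * subset_sum (n - w) (\<lambda>b. q (a + b))) [0..<1 + w]"
    unfolding n funpow_adjacent_sums_map by (simp add: map2_map_map del: upt_Suc)
  then show ?thesis by (simp only: funpow_adjacent_sums_map) simp
qed

text \<open>The list expression is the sum of \<open>root_prod vs (card (B \<inter> A)) * root_prod us (card B)\<close> over all
  \<open>B \<subseteq> UNIV\<close>, with \<open>card A = w\<close> and \<open>card UNIV = n\<close>, written with \<open>n\<close> rounds of additions so that it can be evaluated.\<close>

definition obstruction :: "nat \<Rightarrow> nat list \<Rightarrow> nat list \<Rightarrow> nat \<Rightarrow> bool" where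
  "obstruction n vs us w \<longleftrightarrow>
    hd ((adjacent_sums ^^ w) (map2 (*) (map (root_prod vs) [0..<Suc w])
      ((adjacent_sums ^^ (n - w)) (map (root_prod us) [0..<Suc n]))))
    \<noteq> 2 ^ (n div 2) * (root_prod vs w * root_prod us n)"

section \<open>The spanning criterion for Type II codes\<close>

text \<open>The roots \<open>vs\<close> handle the words of weight at most \<open>d\<close>, the
  roots \<open>us\<close> all heavier words except the all-one word; \<open>len\<close> keeps the
  degree below the dual distance.\<close>

lemma type_II_eq_span:
  fixes C :: "(bit ^ 'n) set"
  assumes "type_II C"
    and dist: "\<And>x. x \<in> C \<Longrightarrow> x \<noteq> 0 \<Longrightarrow> d \<le> hamming_weight x"
    and len: "length vs + length us < d"
    and vs: "\<And>k. even k \<Longrightarrow> k \<le> d div 2 \<Longrightarrow> k \<in> set vs"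
    and us: "\<And>k. 4 dvd k \<Longrightarrow> d < k \<Longrightarrow> k \<le> CARD('n) - d \<Longrightarrow> k \<in> set us"
    and obstr: "\<And>w. 4 dvd w \<Longrightarrow> d < w \<Longrightarrow> w \<le> CARD('n) \<Longrightarrow> obstruction (CARD('n)) vs us w"
  shows "C = vec.span {x \<in> C. hamming_weight x = d}"
proof (rule ccontr)
  let ?S = "vec.span {x \<in> C. hamming_weight x = d}"
  assume "C \<noteq> ?S"
  have sub: "vec.subspace C" and dual: "dual_code C = C"
    and four: "\<And>x. x \<in> C \<Longrightarrow> 4 dvd hamming_weight x"
    using assms(1) by (auto simp: type_II_def self_dual_def doubly_even_def)
  have "?S \<subseteq> C" using sub by (intro vec.span_minimal) auto
  with \<open>C \<noteq> ?S\<close> obtain z where "z \<in> C \<and> z \<notin> ?S" by blast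
  then obtain c where c: "c \<in> C" "c \<notin> ?S"
    and least: "\<And>x. x \<in> C \<Longrightarrow> x \<notin> ?S \<Longrightarrow> hamming_weight c \<le> hamming_weight x"
    using ex_has_least_nat [of "\<lambda>x. x \<in> C \<and> x \<notin> ?S" z hamming_weight] by blast
  have even_Int: "even (card (support x \<inter> support y))" if "x \<in> C" "y \<in> C" for x y
    using that dual mem_dual_code_iff by blast
  have supp_1: "support (1 :: bit ^ 'n) = UNIV" by (simp add: support_eq_UNIV_iff)
  \<comment> \<open>Every codeword is orthogonal to itself, hence of even weight, hence orthogonal
    to the all-one word.\<close>
  have one: "1 \<in> C"
  proof -
    have "even (card (support x))" if "x \<in> C" for x
      using even_Int [OF that that] by simp
    then have "1 \<in> dual_code C" by (simp add: mem_dual_code_iff supp_1)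
    then show ?thesis using dual by simp
  qed
  let ?w = "hamming_weight c" and ?A = "support c"
  let ?f = "\<lambda>x. root_prod vs (card (support x \<inter> ?A)) * root_prod us (card (support x))"
  have "c \<noteq> 0" using c(2) vec.span_zero by blast
  have base: "x \<in> ?S" if "x \<in> C" "hamming_weight x = d" for x
    by (rule vec.span_base) (use that in simp)
  then have "?w \<noteq> d" using c by metis
  with \<open>c \<noteq> 0\<close> have w: "d < ?w" using dist [OF c(1)] by simp
  have "?f x = 0" if x: "x \<in> C" "x \<noteq> 1" for x
  proof (cases "hamming_weight x \<le> d")
    case True
    \<comment> \<open>A nonzero \<open>x\<close> here lies in the span, so \<open>x + c\<close> does
      not and weighs at least as much as \<open>c\<close>. Its weight is that of \<open>c\<close>
      plus \<open>d\<close> minus twice the intersection number.\<close>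
    have "card (support x \<inter> ?A) \<le> d div 2"
    proof (cases "x = 0")
      case False
      then have wx: "hamming_weight x = d" using True dist x by force
      then have "x \<in> ?S" using x base by simp
      then have "x + c \<notin> ?S" using c(2) vec.span_diff [of "x + c" _ x] by auto
      then have "?w \<le> hamming_weight (x + c)"
        using least x c(1) vec.subspace_add [OF sub] by blast
      then show ?thesis using hamming_weight_add [of x c] wx by simp
    qed (use support_eq_empty_iff [of x] in simp)
    then show ?thesis using vs even_Int [OF x(1) c(1)] by (simp add: root_prod_eq_0)
  next
    case False
    \<comment> \<open>The complement of \<open>x\<close> is a nonzero codeword, which bounds the
      weight of \<open>x\<close> by \<open>n - d\<close>.\<close>
    have "x + 1 \<noteq> 0"
      using x(2) by (auto simp: vec_eq_iff add_eq_0_iff)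
    then have "d \<le> hamming_weight (x + 1)"
      using dist x(1) one vec.subspace_add [OF sub] by blast
    then have "hamming_weight x \<le> CARD('n) - d"
      using hamming_weight_add [of x 1] card_mono [of UNIV "support x"]
      by (simp add: supp_1 hamming_weight_eq)
    then have "hamming_weight x \<in> set us" using us four [OF x(1)] False by simp
    then show ?thesis by (simp add: root_prod_eq_0 hamming_weight_eq)
  qed
  then have "(\<Sum>x\<in>C - {1}. ?f x) = 0" by (intro sum.neutral) blast
  then have "(\<Sum>x\<in>C. ?f x) = ?f 1" using one by (simp add: sum.remove finite_bit_vec)
  also have "\<dots> = root_prod vs ?w * root_prod us (CARD('n))"
    by (simp add: supp_1 hamming_weight_eq)
  finally have sum_C: "(\<Sum>x\<in>C. ?f x) = root_prod vs ?w * root_prod us (CARD('n))" .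
  have sum_UNIV: "(\<Sum>x\<in>UNIV. ?f x)
      = subset_sum ?w (\<lambda>a. root_prod vs a * subset_sum (CARD('n) - ?w) (\<lambda>b. root_prod us (a + b)))"
    unfolding hamming_weight_eq by (rule sum_support_eq_subset_sum)
  \<comment> \<open>Self-duality makes \<open>card C\<close> a square root of \<open>2 ^ n\<close>;
    since \<open>n\<close> is even, it is \<open>2 ^ (n div 2)\<close>.\<close>
  have "even (CARD('n))" using even_Int [OF one one] by (simp add: supp_1)
  then have n: "(2 :: nat) ^ CARD('n) = (2 ^ (CARD('n) div 2)) ^ 2"
    by (metis dvd_div_mult_self power_mult)
  have "card C ^ 2 = (2 ^ (CARD('n) div 2)) ^ 2"
    using card_mult_card_dual_code [OF sub] by (simp only: dual n power2_eq_square)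
  then have card_C: "card C = 2 ^ (CARD('n) div 2)"
    by (subst (asm) power_eq_iff_eq_base) auto
  have "int (2 ^ CARD('n)) * (\<Sum>x\<in>C. ?f x) = int (card C) * (\<Sum>x\<in>UNIV. ?f x)"
    using sum_dual_distance [OF sub, of vs us ?A] dist len dual by force
  also have "int (2 ^ CARD('n)) = int (card C) * 2 ^ (CARD('n) div 2)"
    unfolding n by (simp add: card_C power2_eq_square)
  finally have "2 ^ (CARD('n) div 2) * (\<Sum>x\<in>C. ?f x) = (\<Sum>x\<in>UNIV. ?f x)"
    by (simp add: card_C mult.assoc)
  moreover have w': "?w \<le> CARD('n)"
    unfolding hamming_weight_eq by (rule card_mono) auto
  ultimately show False
    using obstr [OF four [OF c(1)] w w']
    unfolding obstruction_def subset_sum_mult_eq [OF w', symmetric] sum_C sum_UNIV by simp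
qed

section \<open>The lengths 48 and 72\<close>

text \<open>Here \<open>d = 12\<close>: the roots are the even numbers up to 6 and the multiples of
  4 from 16 to 36, of total degree 10.\<close>

lemma obstruction_48:
  "list_all (obstruction 48 [0, 2, 4, 6] [16, 20, 24, 28, 32, 36]) [16, 20, 24, 28, 32, 36, 40, 44, 48]"
  by code_simp

text \<open>Here \<open>d = 16\<close>, and the total degree 5 + 10 = 15 is the largest that
  \<open>len\<close> permits.\<close>

lemma obstruction_72:
  "list_all (obstruction 72 [0, 2, 4, 6, 8] [20, 24, 28, 32, 36, 40, 44, 48, 52, 56])
    [20, 24, 28, 32, 36, 40, 44, 48, 52, 56, 60, 64, 68, 72]"
  by code_simp

lemma extremal_type_II_eq_span:
  fixes C :: "(bit ^ 'n) set"
  assumes "CARD('n) \<in> {48, 72}" and "extremal_type_II C"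
  shows "C = vec.span {x \<in> C. hamming_weight x = 4 * (CARD('n) div 24) + 4}"
proof -
  have type: "type_II C"
    and dist: "\<And>x. x \<in> C \<Longrightarrow> x \<noteq> 0 \<Longrightarrow> 4 * (CARD('n) div 24) + 4 \<le> hamming_weight x"
    using assms(2) by (auto simp: extremal_type_II_def not_less)
  consider "CARD('n) = 48" | "CARD('n) = 72" using assms(1) by blast
  then show ?thesis
  proof cases
    case 1
    show ?thesis
    proof (rule type_II_eq_span [where vs = "[0, 2, 4, 6]" and us = "[16, 20, 24, 28, 32, 36]"])
      show "k \<in> set [0, 2, 4, 6]" if "even k" "k \<le> (4 * (CARD('n) div 24) + 4) div 2" for k :: nat
        using that unfolding 1 by simp presburger
      show "k \<in> set [16, 20, 24, 28, 32, 36]"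
        if "4 dvd k" "4 * (CARD('n) div 24) + 4 < k" "k \<le> CARD('n) - (4 * (CARD('n) div 24) + 4)" for k :: nat
        using that unfolding 1 by simp presburger
      show "obstruction (CARD('n)) [0, 2, 4, 6] [16, 20, 24, 28, 32, 36] w"
        if w: "4 dvd w" "4 * (CARD('n) div 24) + 4 < w" "w \<le> CARD('n)" for w
      proof -
        have "w \<in> set [16, 20, 24, 28, 32, 36, 40, 44, 48]"
          using w unfolding 1 by simp presburger
        then show ?thesis
          using obstruction_48 by (simp only: list_all_iff 1)
      qed
    qed (use type dist 1 in simp_all)
  next
    case 2
    show ?thesis
    proof (rule type_II_eq_span [where vs = "[0, 2, 4, 6, 8]" and us = "[20, 24, 28, 32, 36, 40, 44, 48, 52, 56]"])
      show "k \<in> set [0, 2, 4, 6, 8]" if "even k" "k \<le> (4 * (CARD('n) div 24) + 4) div 2" for k :: nat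
        using that unfolding 2 by simp presburger
      show "k \<in> set [20, 24, 28, 32, 36, 40, 44, 48, 52, 56]"
        if "4 dvd k" "4 * (CARD('n) div 24) + 4 < k" "k \<le> CARD('n) - (4 * (CARD('n) div 24) + 4)" for k :: nat
        using that unfolding 2 by simp presburger
      show "obstruction (CARD('n)) [0, 2, 4, 6, 8] [20, 24, 28, 32, 36, 40, 44, 48, 52, 56] w"
        if w: "4 dvd w" "4 * (CARD('n) div 24) + 4 < w" "w \<le> CARD('n)" for w
      proof -
        have "w \<in> set [20, 24, 28, 32, 36, 40, 44, 48, 52, 56, 60, 64, 68, 72]"
          using w unfolding 2 by simp presburger
        then show ?thesis
          using obstruction_72 by (simp only: list_all_iff 2)
      qed
    qed (use type dist 2 in simp_all)
  qed
qed

theorem theorem3p2: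
  fixes C :: "(bit ^ 'n) set" and m :: nat
  assumes "CARD('n) \<in> {48, 72}"
    and "extremal_type_II C"
    and "m = min_weight C"
  shows "C = vec.span {c \<in> C. hamming_weight c = m}"
proof -
  let ?d = "4 * (CARD('n) div 24) + 4"
  have span: "C = vec.span {c \<in> C. hamming_weight c = ?d}"
    using assms(1,2) by (rule extremal_type_II_eq_span)
  have dual: "dual_code C = C"
    and dist: "\<And>x. x \<in> C \<Longrightarrow> x \<noteq> 0 \<Longrightarrow> ?d \<le> hamming_weight x"
    using assms(2) by (auto simp: extremal_type_II_def type_II_def self_dual_def not_less)
  \<comment> \<open>A nonzero \<open>C\<close> cannot be the span of the empty set, so weight
    \<open>?d\<close> is attained and equals \<open>m\<close>. The zero code is excluded because its
    dual contains the all-one word.\<close>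
  have "C \<noteq> {0}"
  proof
    assume C: "C = {0}"
    have "1 \<in> dual_code C" by (simp add: C mem_dual_code_iff support_def)
    then have "(1 :: bit ^ 'n) = 0" unfolding dual by (simp add: C)
    then show False by (simp add: vec_eq_iff)
  qed
  then have "{c \<in> C. hamming_weight c = ?d} \<noteq> {}"
    using span vec.span_empty by metis
  then obtain c where c: "c \<in> C" "hamming_weight c = ?d" by blast
  have "m = ?d"
    unfolding assms(3) min_weight_def
  proof (rule Min_eqI)
    show "finite (hamming_weight ` (C - {0}))" by (simp add: finite_bit_vec)
    show "?d \<in> hamming_weight ` (C - {0})"
      using c by (intro image_eqI [of _ _ c]) (auto simp: hamming_weight_def)
  qed (use dist in auto)
  then show ?thesis using span by simp
qed

end
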